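(* Let $n,k$ be positive integers with $\gcd(6k,n)=1$, let $q=2^n$, and let $\phi_k:\mathbb{F}_q^2\to\mathbb{F}_q^2$ be $\phi_k(x,y)=(x^{2^k}+y,\; y^{2^k}+x+y)$. Then the three affine planes $\mathrm{AG}(2,q)$, $\mathrm{AG}(2,q)^{\phi_k}$ and $\mathrm{AG}(2,q)^{\phi_k\circ\phi_k}$ are mutually orthogoval.
   Context: $\mathrm{AG}(2,q)$ denotes the standard Desarguesian affine plane with point set $\mathbb{F}_q^2$ whose lines are the sets $\{(x,y): ax+by=c\}$ with $(a,b)\neq(0,0)$. For a bijection $f$ of $\mathbb{F}_q^2$, $\mathrm{AG}(2,q)^f$ denotes the affine plane on $\mathbb{F}_q^2$ whose lines are the images $f(L)$ of the lines $L$ of $\mathrm{AG}(2,q)$. Two affine planes of the same order on the same point set are orthogoval if every line of one meets every line of the other in at most two points; a set of planes is mutually orthogoval if pairwise orthogoval. *)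

theory Defs
  imports "HOL-Library.Cardinality"
begin

record 'p plane =
  points :: "'p set"
  lines :: "'p set set"

text \<open>
  The usual axioms: lines are sets of points, two distinct points lie on exactly one line,
  Playfair's parallel axiom, and the existence of three non-collinear points.
\<close>

definition affine_plane :: "'p plane \<Rightarrow> bool" where
  "affine_plane A \<longleftrightarrow>
     (\<forall>l\<in>lines A. l \<subseteq> points A) \<and>
     (\<forall>p\<in>points A. \<forall>r\<in>points A. p \<noteq> r \<longrightarrow> (\<exists>!l. l \<in> lines A \<and> p \<in> l \<and> r \<in> l)) \<and>
     (\<forall>l\<in>lines A. \<forall>p\<in>points A. p \<notin> l \<longrightarrow> (\<exists>!m. m \<in> lines A \<and> p \<in> m \<and> m \<inter> l = {})) \<and>
     (\<exists>p\<in>points A. \<exists>r\<in>points A. \<exists>s\<in>points A.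
        p \<noteq> r \<and> p \<noteq> s \<and> r \<noteq> s \<and> \<not> (\<exists>l\<in>lines A. p \<in> l \<and> r \<in> l \<and> s \<in> l))"

definition affine_plane_of_order :: "nat \<Rightarrow> 'p plane \<Rightarrow> bool" where
  "affine_plane_of_order q A \<longleftrightarrow> affine_plane A \<and> (\<forall>l\<in>lines A. finite l \<and> card l = q)"

definition AG2 :: "('a::field \<times> 'a) plane" where
  "AG2 = \<lparr>points = UNIV,
          lines = {{(x, y). a * x + b * y = c} | a b c. (a, b) \<noteq> (0, 0)}\<rparr>"

text \<open>Meant for a bijection \<open>f\<close> of the point set onto itself, hence the unchanged point set.\<close>

definition plane_image :: "'p plane \<Rightarrow> ('p \<Rightarrow> 'p) \<Rightarrow> 'p plane" where
  "plane_image A f = \<lparr>points = points A, lines = (\<lambda>l. f ` l) ` lines A\<rparr>"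

definition orthogoval :: "'p plane \<Rightarrow> 'p plane \<Rightarrow> bool" where
  "orthogoval A B \<longleftrightarrow>
     (\<exists>q. affine_plane_of_order q A \<and> affine_plane_of_order q B) \<and>
     points A = points B \<and>
     (\<forall>l\<in>lines A. \<forall>m\<in>lines B. finite (l \<inter> m) \<and> card (l \<inter> m) \<le> 2)"

text \<open>
  Planes are given as a list rather than a set, so that two entries that happen to coincide
  are still compared with each other.
\<close>

definition mutually_orthogoval :: "'p plane list \<Rightarrow> bool" where
  "mutually_orthogoval As \<longleftrightarrow>
     (\<forall>i<length As. \<forall>j<length As. i \<noteq> j \<longrightarrow> orthogoval (As ! i) (As ! j))"

definition phi :: "nat \<Rightarrow> 'a::field \<times> 'a \<Rightarrow> 'a \<times> 'a" where
  "phi k = (\<lambda>(x, y). (x ^ (2 ^ k) + y, y ^ (2 ^ k) + x + y))"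

end

theory Submission
  imports Defs "HOL-Library.Product_Plus"
begin

text \<open>
  Write \<open>\<sigma>\<close> for the automorphism \<open>x \<mapsto> x ^ 2 ^ k\<close>, so that \<open>\<phi>\<^sub>k v = \<sigma> v + M v\<close>
  with a matrix \<open>M\<close> of order 3 over the field with two elements. On a line \<open>p + t v\<close> an equation
  \<open>a x + b y = c\<close> for the image under \<open>\<phi>\<^sub>k\<close> takes the form \<open>A t ^ 2 ^ k + B t = const\<close>. Since 1 is
  the only nonzero fixed point of \<open>\<sigma>\<close>, this has at most two solutions unless \<open>A = B = 0\<close>, which
  forces \<open>\<sigma> v\<close> and \<open>M v\<close> to be proportional. In that case \<open>\<sigma>\<close> acts on the slope of \<open>v\<close> as a
  projectivity of order 3, so the slope is fixed by \<open>\<sigma> ^ 3\<close> and lies in the prime field,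
  which is impossible. As \<open>\<phi>\<^sub>k \<circ> \<phi>\<^sub>k\<close> is \<open>\<phi>\<^bsub>2k\<^esub>\<close> conjugated by the swap of coordinates, the same
  argument compares the first plane with the third; the remaining pair is the image
  of the first pair under \<open>\<phi>\<^sub>k\<close>.
\<close>

section \<open>Finite fields of even order\<close>

text \<open>Multiplication by a nonzero \<open>x\<close> permutes the nonzero elements, so comparing
  their product before and after shows that \<open>x\<close> to the number of them is 1.\<close>

lemma finite_field_power_CARD:
  fixes x :: "'a::{field,finite}"
  shows "x ^ CARD('a) = x"
proof (cases "x = 0")
  case False
  let ?U = "UNIV - {0::'a}"
  have "bij_betw ((*) x) ?U ?U"
    by (rule bij_betw_byWitness[where f' = "\<lambda>y. y / x"]) (use False in auto)
  then have "\<Prod>?U = (\<Prod>y\<in>?U. x * y)"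
    by (rule prod.reindex_bij_betw[symmetric])
  also have "\<dots> = x ^ card ?U * \<Prod>?U"
    by (simp add: prod.distrib)
  finally have "x ^ card ?U = 1"
    by simp
  moreover have "CARD('a) = Suc (card ?U)"
    by (rule card.remove) auto
  ultimately show ?thesis
    by (simp only: power_Suc mult_1_right)
qed simp

text \<open>The even power \<open>CARD('a)\<close> fixes -1, so -1 = 1.\<close>

lemma even_field:
  assumes "CARD('a::{field,finite}) = 2 ^ n"
  shows "n > 0" and "(2::'a) = 0"
proof -
  have "card {0, 1::'a} \<le> CARD('a)"
    by (rule card_mono) auto
  then show "n > 0"
    using assms by (cases n) auto
  then have "(- 1::'a) = (- 1) ^ CARD('a)" "even (2 ^ n :: nat)"
    by (simp_all add: finite_field_power_CARD)
  then have "(- 1::'a) = 1"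
    using assms by simp
  then show "(2::'a) = 0"
    by (metis add.right_inverse one_add_one)
qed

lemma add_power_2_power:
  fixes x y :: "'a::comm_ring_1"
  assumes "(2::'a) = 0"
  shows "(x + y) ^ 2 ^ k = x ^ 2 ^ k + y ^ 2 ^ k"
  by (induction k) (simp_all add: power_mult power2_sum assms mult.commute[of 2])

lemma power_2_power_fixed_mult:
  fixes x :: "'a::monoid_mult"
  assumes "x ^ 2 ^ j = x"
  shows "x ^ 2 ^ (j * i) = x"
  by (induction i) (simp_all add: power_add power_mult assms)

text \<open>The exponents \<open>i\<close> for which \<open>x ^ 2 ^ i = x\<close> include
  \<open>j\<close> and \<open>n\<close>; by coprimality squaring itself fixes \<open>x\<close>, so
  \<open>x\<close> lies in the prime field.\<close>

lemma power_2_power_fixed: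
  fixes x :: "'a::{field,finite}"
  assumes "CARD('a) = 2 ^ n" and "coprime j n" and "x ^ 2 ^ j = x"
  shows "x = 0 \<or> x = 1"
proof -
  \<comment> \<open>This one-sided form of Bezout over the naturals wants a nonzero first argument,
    hence \<open>n\<close> in front.\<close>
  obtain a b where ab: "n * a = j * b + 1"
    using bezout_nat[of n j] even_field(1)[OF assms(1)] assms(2)
    by (auto simp: coprime_iff_gcd_eq_1 gcd.commute)
  have "x = x ^ 2 ^ (n * a)"
    using power_2_power_fixed_mult[of x n] finite_field_power_CARD[of x] assms(1) by simp
  also have "\<dots> = (x ^ 2 ^ (j * b)) ^ 2"
    by (simp add: ab power_add flip: power_mult) (simp add: mult.commute)
  also have "\<dots> = x ^ 2"
    by (simp add: power_2_power_fixed_mult[OF assms(3)])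
  finally show ?thesis
    by (simp add: power2_eq_square)
qed

section \<open>Lines and affine planes\<close>

definition line :: "'a::field \<Rightarrow> 'a \<Rightarrow> 'a \<Rightarrow> ('a \<times> 'a) set" where
  "line a b c = {(x, y). a * x + b * y = c}"

lemma mem_line [simp]: "(x, y) \<in> line a b c \<longleftrightarrow> a * x + b * y = c"
  by (simp add: line_def)

lemma points_AG2 [simp]: "points AG2 = UNIV"
  by (simp add: AG2_def)

lemma lines_AG2: "lines AG2 = {line a b c | a b c. (a, b) \<noteq> (0, 0)}"
  by (simp add: AG2_def line_def)

section \<open>Incidence of lines in coordinates\<close>

lemma line_direction:
  fixes a b :: "'a::field"
  assumes "(a, b) \<noteq> (0, 0)" and "(x, y) \<in> line a b c" and "(x', y') \<in> line a b c"
  obtains t where "x' = x - t * b" and "y' = y + t * a"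
proof (cases "a = 0")
  case True
  then show ?thesis
    using assms that[of "(x - x') / b"] by auto
next
  case False
  have "a * x' = a * x - (y' - y) * b"
    using assms(2,3) by (simp add: algebra_simps)
  then have "x' = x - (y' - y) / a * b"
    using False by (simp add: field_simps)
  then show ?thesis
    using False that[of "(y' - y) / a"] by simp
qed

lemma line_subset:
  fixes a b :: "'a::field"
  assumes "(a, b) \<noteq> (0, 0)" and "a * b' = a' * b"
    and "(x, y) \<in> line a b c" and "(x, y) \<in> line a' b' c'"
  shows "line a b c \<subseteq> line a' b' c'"
proof (rule subrelI)
  fix x' y' assume "(x', y') \<in> line a b c"
  then obtain t where t: "x' = x - t * b" "y' = y + t * a"
    using line_direction assms(1,3) by metis
  have "a' * x' + b' * y' = a' * x + b' * y + t * (a * b' - a' * b)"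
    by (simp add: t algebra_simps)
  then show "(x', y') \<in> line a' b' c'"
    using assms(2,4) by simp
qed

text \<open>Parallelism is expressed by the vanishing determinant of the two normal vectors, which
  avoids slopes and the special case of vertical lines.\<close>

lemma line_eqI:
  fixes a b :: "'a::field"
  assumes "(a, b) \<noteq> (0, 0)" and "(a', b') \<noteq> (0, 0)" and "a * b' = a' * b"
    and "(x, y) \<in> line a b c" and "(x, y) \<in> line a' b' c'"
  shows "line a b c = line a' b' c'"
  using line_subset[of a b b' a' x y c c'] line_subset[of a' b' b a x y c' c] assms by auto

lemma line_through_unique:
  fixes a b :: "'a::field"
  assumes "(a, b) \<noteq> (0, 0)" and "(a', b') \<noteq> (0, 0)" and "(x, y) \<noteq> (x', y')"
    and "(x, y) \<in> line a b c" and "(x', y') \<in> line a b c"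
    and "(x, y) \<in> line a' b' c'" and "(x', y') \<in> line a' b' c'"
  shows "line a b c = line a' b' c'"
proof -
  obtain t where t: "x' = x - t * b" "y' = y + t * a"
    using line_direction assms(1,4,5) by metis
  then have "t \<noteq> 0"
    using assms(3) by auto
  have "t * (a * b' - a' * b) = (a' * x' + b' * y') - (a' * x + b' * y)"
    by (simp add: t algebra_simps)
  then have "a * b' = a' * b"
    using assms(6,7) \<open>t \<noteq> 0\<close> by simp
  then show ?thesis
    using line_eqI assms by metis
qed

text \<open>Cramer's rule; the contrapositive gives uniqueness of parallels.\<close>

lemma lines_intersect:
  fixes a b :: "'a::field"
  assumes "a * b' \<noteq> a' * b"
  shows "line a b c \<inter> line a' b' c' \<noteq> {}"
proof -
  let ?d = "a * b' - a' * b"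
  have "a * (c * b' - c' * b) + b * (a * c' - a' * c) = c * ?d"
    and "a' * (c * b' - c' * b) + b' * (a * c' - a' * c) = c' * ?d"
    by (simp_all add: algebra_simps)
  then have "((c * b' - c' * b) / ?d, (a * c' - a' * c) / ?d) \<in> line a b c \<inter> line a' b' c'"
    using assms by (simp flip: add_divide_distrib)
  then show ?thesis
    by blast
qed

lemma card_line:
  fixes a b c :: "'a::field"
  assumes "(a, b) \<noteq> (0, 0)"
  shows "card (line a b c) = CARD('a)"
proof (cases "b = 0")
  case True
  then have "line a b c = range (\<lambda>y. (c / a, y))"
    using assms by (auto simp: line_def field_simps)
  then show ?thesis
    by (simp add: card_image inj_on_def)
next
  case False
  then have "line a b c = range (\<lambda>x. (x, (c - a * x) / b))"
    by (auto simp: line_def field_simps)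
  then show ?thesis
    by (simp add: card_image inj_on_def)
qed

lemma affine_plane_AG2: "affine_plane (AG2 :: ('a::field \<times> 'a) plane)"
  unfolding affine_plane_def points_AG2
proof (intro conjI ballI impI)
  fix p r :: "'a \<times> 'a" assume "p \<noteq> r"
  obtain x y x' y' where p: "p = (x, y)" and r: "r = (x', y')"
    by (cases p, cases r)
  show "\<exists>!l. l \<in> lines AG2 \<and> p \<in> l \<and> r \<in> l"
  proof (rule ex_ex1I)
    \<comment> \<open>The normal vector is the difference of the two points turned by a right angle;
      the constant is the value of the linear form at \<open>p\<close>.\<close>
    let ?l = "line (y' - y) (x - x') ((y' - y) * x + (x - x') * y)"
    have "(y' - y, x - x') \<noteq> (0, 0)"
      using \<open>p \<noteq> r\<close> by (auto simp: p r)
    then have "?l \<in> lines AG2"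
      unfolding lines_AG2 by blast
    moreover have "p \<in> ?l" "r \<in> ?l"
      by (simp_all add: p r algebra_simps)
    ultimately show "\<exists>l. l \<in> lines AG2 \<and> p \<in> l \<and> r \<in> l"
      by blast
  next
    fix l m
    assume "l \<in> lines AG2 \<and> p \<in> l \<and> r \<in> l" "m \<in> lines AG2 \<and> p \<in> m \<and> r \<in> m"
    then show "l = m"
      using line_through_unique \<open>p \<noteq> r\<close> unfolding lines_AG2 p r by blast
  qed
next
  fix l and p :: "'a \<times> 'a" assume "l \<in> lines AG2" "p \<notin> l"
  obtain a b c where l: "l = line a b c" and ab: "(a, b) \<noteq> (0, 0)"
    using \<open>l \<in> lines AG2\<close> unfolding lines_AG2 by blast
  obtain x y where p: "p = (x, y)"
    by (cases p)
  let ?m = "line a b (a * x + b * y)"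
  show "\<exists>!m. m \<in> lines AG2 \<and> p \<in> m \<and> m \<inter> l = {}"
  proof (rule ex1I[of _ ?m])
    have "?m \<in> lines AG2"
      using ab unfolding lines_AG2 by blast
    moreover have "p \<in> ?m" "?m \<inter> l = {}"
      using \<open>p \<notin> l\<close> by (auto simp: p l)
    ultimately show "?m \<in> lines AG2 \<and> p \<in> ?m \<and> ?m \<inter> l = {}"
      by blast
  next
    fix m assume m: "m \<in> lines AG2 \<and> p \<in> m \<and> m \<inter> l = {}"
    then obtain a' b' c' where m': "m = line a' b' c'" "(a', b') \<noteq> (0, 0)"
      unfolding lines_AG2 by blast
    \<comment> \<open>Otherwise \<open>m\<close> and \<open>l\<close> would meet.\<close>
    have "a' * b = a * b'"
      using m lines_intersect[of a' b a b' c' c] by (auto simp: m' l)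
    then show "m = ?m"
      using line_eqI[of a' b' a b x y c'] m m' ab by (auto simp: p)
  qed
next
  have "\<not> (\<exists>l\<in>lines AG2. (0::'a, 0::'a) \<in> l \<and> (1, 0) \<in> l \<and> (0, 1) \<in> l)"
    by (auto simp: lines_AG2)
  then show "\<exists>p\<in>UNIV. \<exists>r\<in>UNIV. \<exists>s\<in>UNIV. p \<noteq> r \<and> p \<noteq> s \<and> r \<noteq> s \<and>
      \<not> (\<exists>l\<in>lines (AG2 :: ('a \<times> 'a) plane). p \<in> l \<and> r \<in> l \<and> s \<in> l)"
    by - (rule bexI[of _ "(0, 0)"], rule bexI[of _ "(1, 0)"], rule bexI[of _ "(0, 1)"], simp_all)
qed simp

lemma affine_plane_of_order_AG2:
  "affine_plane_of_order CARD('a) (AG2 :: ('a::{field,finite} \<times> 'a) plane)"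
  unfolding affine_plane_of_order_def using affine_plane_AG2 card_line
  by (auto simp: lines_AG2)

section \<open>Images of planes under bijections\<close>

lemma points_plane_image [simp]: "points (plane_image A f) = points A"
  and lines_plane_image: "lines (plane_image A f) = (\<lambda>l. f ` l) ` lines A"
  by (simp_all add: plane_image_def)

lemma plane_image_comp: "plane_image A (f \<circ> g) = plane_image (plane_image A g) f"
  by (simp add: plane_image_def image_image image_comp)

text \<open>\<open>f\<close> is an isomorphism onto the image plane: \<open>mem\<close>,
  \<open>eq\<close> and \<open>disj\<close> translate incidence, equality and disjointness back to
  \<open>A\<close>, where each axiom is applied.\<close>

lemma affine_plane_plane_image:
  assumes A: "affine_plane A" and f: "bij_betw f (points A) (points A)"
  shows "affine_plane (plane_image A f)"
proof -
  have sub: "l \<subseteq> points A" if "l \<in> lines A" for l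
    using A that by (simp add: affine_plane_def)
  have joining: "\<exists>!l. l \<in> lines A \<and> p \<in> l \<and> r \<in> l"
    if "p \<in> points A" "r \<in> points A" "p \<noteq> r" for p r
    using A that by (simp add: affine_plane_def)
  have parallel: "\<exists>!m. m \<in> lines A \<and> p \<in> m \<and> m \<inter> l = {}"
    if "l \<in> lines A" "p \<in> points A" "p \<notin> l" for l p
    using A that by (simp add: affine_plane_def)
  have surj: "\<exists>p'\<in>points A. p = f p'" if "p \<in> points A" for p
    using f that unfolding bij_betw_def by blast
  have mem: "f p \<in> f ` l \<longleftrightarrow> p \<in> l" if "p \<in> points A" "l \<in> lines A" for p l
    using inj_on_image_mem_iff[OF bij_betw_imp_inj_on[OF f]] sub that by blast
  have eq: "f p = f r \<longleftrightarrow> p = r" if "p \<in> points A" "r \<in> points A" for p r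
    using inj_on_eq_iff[OF bij_betw_imp_inj_on[OF f]] that by blast
  have disj: "f ` m \<inter> f ` l = {} \<longleftrightarrow> m \<inter> l = {}" if "m \<in> lines A" "l \<in> lines A" for m l
    using inj_on_image_Int[OF bij_betw_imp_inj_on[OF f], of m l] sub that by auto
  show ?thesis
    unfolding affine_plane_def points_plane_image lines_plane_image
  proof (intro conjI ballI impI)
    fix l assume "l \<in> (\<lambda>l. f ` l) ` lines A"
    then show "l \<subseteq> points A"
      using sub bij_betw_imp_surj_on[OF f] by blast
  next
    fix p r assume "p \<in> points A" "r \<in> points A" "p \<noteq> r"
    then obtain p' r' where p: "p' \<in> points A" "p = f p'" and r: "r' \<in> points A" "r = f r'"
      using surj by metis
    then have "\<exists>!l. l \<in> lines A \<and> p' \<in> l \<and> r' \<in> l"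
      using \<open>p \<noteq> r\<close> by (intro joining) auto
    then obtain l where l: "l \<in> lines A" "p' \<in> l" "r' \<in> l"
      and uniq: "\<And>m. m \<in> lines A \<Longrightarrow> p' \<in> m \<Longrightarrow> r' \<in> m \<Longrightarrow> m = l"
      by (elim ex1E) blast
    show "\<exists>!l. l \<in> (\<lambda>l. f ` l) ` lines A \<and> p \<in> l \<and> r \<in> l"
    proof (rule ex1I[of _ "f ` l"])
      show "f ` l \<in> (\<lambda>l. f ` l) ` lines A \<and> p \<in> f ` l \<and> r \<in> f ` l"
        using l p r by blast
    next
      fix m assume m: "m \<in> (\<lambda>l. f ` l) ` lines A \<and> p \<in> m \<and> r \<in> m"
      then obtain m' where "m' \<in> lines A" "m = f ` m'"
        by blast
      then show "m = f ` l"
        using m uniq mem p r by metis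
    qed
  next
    fix l p assume "l \<in> (\<lambda>l. f ` l) ` lines A" "p \<in> points A" "p \<notin> l"
    then obtain l' p' where l: "l' \<in> lines A" "l = f ` l'" and p: "p' \<in> points A" "p = f p'"
      using surj by blast
    then have "\<exists>!m. m \<in> lines A \<and> p' \<in> m \<and> m \<inter> l' = {}"
      using \<open>p \<notin> l\<close> by (intro parallel) auto
    then obtain m where m: "m \<in> lines A" "p' \<in> m" "m \<inter> l' = {}"
      and uniq: "\<And>m'. m' \<in> lines A \<Longrightarrow> p' \<in> m' \<Longrightarrow> m' \<inter> l' = {} \<Longrightarrow> m' = m"
      by (elim ex1E) blast
    show "\<exists>!m. m \<in> (\<lambda>l. f ` l) ` lines A \<and> p \<in> m \<and> m \<inter> l = {}"
    proof (rule ex1I[of _ "f ` m"])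
      show "f ` m \<in> (\<lambda>l. f ` l) ` lines A \<and> p \<in> f ` m \<and> f ` m \<inter> l = {}"
        using m p l disj by blast
    next
      fix n assume n: "n \<in> (\<lambda>l. f ` l) ` lines A \<and> p \<in> n \<and> n \<inter> l = {}"
      then obtain n' where "n' \<in> lines A" "n = f ` n'"
        by blast
      then show "n = f ` m"
        using n uniq mem disj p l by metis
    qed
  next
    obtain p r s where prs: "p \<in> points A" "r \<in> points A" "s \<in> points A"
      "p \<noteq> r" "p \<noteq> s" "r \<noteq> s" "\<not> (\<exists>l\<in>lines A. p \<in> l \<and> r \<in> l \<and> s \<in> l)"
      using A unfolding affine_plane_def by (elim conjE bexE) (rule that)
    have "f p \<in> points A" "f r \<in> points A" "f s \<in> points A"
      using f prs(1-3) by (auto dest: bij_betwE)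
    moreover have "f p \<noteq> f r" "f p \<noteq> f s" "f r \<noteq> f s"
      using prs eq by auto
    moreover have "\<not> (\<exists>l\<in>(\<lambda>l. f ` l) ` lines A. f p \<in> l \<and> f r \<in> l \<and> f s \<in> l)"
      using prs mem by auto
    ultimately show "\<exists>p\<in>points A. \<exists>r\<in>points A. \<exists>s\<in>points A. p \<noteq> r \<and> p \<noteq> s \<and> r \<noteq> s \<and>
        \<not> (\<exists>l\<in>(\<lambda>l. f ` l) ` lines A. p \<in> l \<and> r \<in> l \<and> s \<in> l)"
      by blast
  qed
qed

lemma affine_plane_of_order_plane_image:
  assumes A: "affine_plane_of_order q A" and f: "bij_betw f (points A) (points A)"
  shows "affine_plane_of_order q (plane_image A f)"
proof -
  have "card (f ` l) = card l" if "l \<in> lines A" for l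
    using A that inj_on_subset[OF bij_betw_imp_inj_on[OF f]]
    unfolding affine_plane_of_order_def affine_plane_def by (metis card_image)
  then show ?thesis
    using A affine_plane_plane_image f
    by (auto simp: affine_plane_of_order_def lines_plane_image)
qed

lemma orthogoval_sym: "orthogoval A B \<Longrightarrow> orthogoval B A"
  unfolding orthogoval_def by (metis Int_commute)

text \<open>By injectivity the intersection of two image lines is the image of an intersection, so
  it is no larger.\<close>

lemma orthogoval_plane_image:
  assumes AB: "orthogoval A B" and f: "bij_betw f (points A) (points A)"
  shows "orthogoval (plane_image A f) (plane_image B f)"
proof -
  obtain q where q: "affine_plane_of_order q A" "affine_plane_of_order q B"
    and points: "points B = points A"
    and Int: "\<And>l m. l \<in> lines A \<Longrightarrow> m \<in> lines B \<Longrightarrow> finite (l \<inter> m) \<and> card (l \<inter> m) \<le> 2"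
    using AB unfolding orthogoval_def by auto
  have "finite (f ` l \<inter> f ` m) \<and> card (f ` l \<inter> f ` m) \<le> 2"
    if lm: "l \<in> lines A" "m \<in> lines B" for l m
  proof -
    have "l \<subseteq> points A" "m \<subseteq> points A"
      using q lm points unfolding affine_plane_of_order_def affine_plane_def by auto
    then have "f ` l \<inter> f ` m = f ` (l \<inter> m)"
      using inj_on_image_Int[OF bij_betw_imp_inj_on[OF f]] by simp
    then show ?thesis
      using Int[OF lm] card_image_le[of "l \<inter> m" f] by auto
  qed
  then show ?thesis
    unfolding orthogoval_def
    using q points f affine_plane_of_order_plane_image[of q A f]
      affine_plane_of_order_plane_image[of q B f]
    by (auto simp: lines_plane_image)
qed

section \<open>The map \<open>\<phi>\<^sub>k\<close>\<close>

text \<open>Equality would make the determinant of the vectors (\<open>u ^ 2 ^ k\<close>,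
  \<open>w ^ 2 ^ k\<close>) and (\<open>w\<close>, \<open>u + w\<close>) vanish. The ratio
  \<open>z = u / w\<close> would then be sent by the automorphism to \<open>1 / (z + 1)\<close>, a
  map of order 3 in characteristic 2.\<close>

lemma phi_determinant_nonzero:
  fixes u w :: "'a::{field,finite}"
  assumes card: "CARD('a) = 2 ^ n" and cop: "coprime (3 * k) n" and "(u, w) \<noteq> (0, 0)"
  shows "u ^ 2 ^ k * (u + w) \<noteq> w ^ 2 ^ k * w"
proof
  assume eq: "u ^ 2 ^ k * (u + w) = w ^ 2 ^ k * w"
  have two: "(2::'a) = 0"
    using even_field(2)[OF card] .
  have "w \<noteq> 0"
    using eq assms(3) by auto
  define z where "z = u / w"
  define z1 where "z1 = z ^ 2 ^ k"
  define z2 where "z2 = z1 ^ 2 ^ k"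
  define z3 where "z3 = z2 ^ 2 ^ k"
  have u: "u = z * w"
    using \<open>w \<noteq> 0\<close> by (simp add: z_def)
  have "w ^ 2 ^ k * w * (z1 * (z + 1)) = w ^ 2 ^ k * w * 1"
    using eq by (simp add: u z1_def power_mult_distrib algebra_simps)
  then have z1: "z1 * (z + 1) = 1"
    using \<open>w \<noteq> 0\<close> by (metis mult_cancel_left mult_eq_0_iff power_not_zero)
  have z2: "z2 * (z1 + 1) = 1"
    using arg_cong[OF z1, of "\<lambda>x. x ^ 2 ^ k"]
    by (simp add: power_mult_distrib add_power_2_power[OF two] z1_def z2_def)
  have z3: "z3 * (z2 + 1) = 1"
    using arg_cong[OF z2, of "\<lambda>x. x ^ 2 ^ k"]
    by (simp add: power_mult_distrib add_power_2_power[OF two] z2_def z3_def)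
  \<comment> \<open>Two applications of the map give \<open>z2 = (z + 1) / z\<close>. To see this
    without division, \<open>z\<close> is written as \<open>1 + (z + 1)\<close> in characteristic 2
    and the 1 replaced by \<open>z1 * (z + 1)\<close>, so that \<open>z + 1\<close> factors
    out.\<close>
  have "z2 * z = z2 * (1 + (z + 1)) - 2 * z2"
    by (simp add: algebra_simps)
  also have "\<dots> = z2 * (z1 * (z + 1) + (z + 1)) - 2 * z2"
    by (simp only: z1)
  also have "\<dots> = z2 * (z1 + 1) * (z + 1)"
    by (simp add: two algebra_simps)
  finally have "z2 * z = z + 1"
    by (simp add: z2)
  then have "z3 * (2 * z + 1) = z3 * (z2 * z + z)"
    by (simp only: mult_2) (simp add: ac_simps)
  also have "\<dots> = z3 * (z2 + 1) * z"
    by (simp add: algebra_simps)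
  finally have "z3 = z"
    by (simp add: z3 two)
  moreover have "z3 = z ^ 2 ^ (3 * k)"
    by (simp add: z3_def z2_def z1_def mult.commute[of 3] power_mult[of 2 k 3] power3_eq_cube
        flip: power_mult[of z] power_mult[of z "_ * _"])
  ultimately have "z = 0 \<or> z = 1"
    using power_2_power_fixed[OF card cop, of z] by simp
  \<comment> \<open>Neither value satisfies \<open>z1 * (z + 1) = 1\<close>: the left side is 0 for
    \<open>z = 0\<close>, and \<open>1 + 1 = 0\<close> for \<open>z = 1\<close>.\<close>
  then show False
    using z1 two by (auto simp: z1_def zero_power)
qed

text \<open>A kernel vector has \<open>u ^ 2 ^ k = w\<close> and \<open>w ^ 2 ^ k = u + w\<close>,
  so the two vectors of the determinant would coincide.\<close>

lemma phi_eq_0D: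
  fixes v :: "'a::{field,finite} \<times> 'a"
  assumes card: "CARD('a) = 2 ^ n" and cop: "coprime (3 * k) n" and "phi k v = 0"
  shows "v = 0"
proof (rule ccontr)
  obtain u w where v: "v = (u, w)"
    by (cases v)
  have minus: "- x = x" for x :: 'a
    using even_field(2)[OF card] by (metis add_eq_0_iff2 mult_2 mult_zero_left)
  assume "v \<noteq> 0"
  then have "u ^ 2 ^ k * (u + w) \<noteq> w ^ 2 ^ k * w"
    using phi_determinant_nonzero[OF card cop] by (auto simp: v zero_prod_def)
  moreover have "u ^ 2 ^ k = w" "w ^ 2 ^ k = u + w"
    using assms(3) minus by (auto simp: v phi_def zero_prod_def add.assoc add_eq_0_iff2)
  ultimately show False
    by (simp add: mult.commute)
qed

lemma phi_add:
  fixes p r :: "'a::field \<times> 'a"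
  assumes "(2::'a) = 0"
  shows "phi k (p + r) = phi k p + phi k r"
  by (cases p, cases r) (simp add: phi_def add_power_2_power[OF assms] algebra_simps)

lemma bij_phi:
  assumes card: "CARD('a::{field,finite}) = 2 ^ n" and cop: "coprime (3 * k) n"
  shows "bij (phi k :: 'a \<times> 'a \<Rightarrow> 'a \<times> 'a)"
proof -
  have "inj (phi k :: 'a \<times> 'a \<Rightarrow> 'a \<times> 'a)"
  proof (rule injI)
    fix p r :: "'a \<times> 'a" assume "phi k p = phi k r"
    then have "phi k (p - r) = 0"
      using phi_add[OF even_field(2)[OF card], of k "p - r" r] by simp
    then have "p - r = 0"
      by (rule phi_eq_0D[OF card cop])
    then show "p = r"
      by simp
  qed
  then show ?thesis
    by (simp add: bij_def finite_UNIV_inj_surj)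
qed

lemma orthogoval_AG2_phi:
  assumes card: "CARD('a::{field,finite}) = 2 ^ n" and cop: "coprime (3 * k) n"
  shows "orthogoval (AG2 :: ('a \<times> 'a) plane) (plane_image AG2 (phi k))"
proof -
  have two: "(2::'a) = 0"
    using even_field(2)[OF card] .
  \<comment> \<open>The homogeneous core: on a line through the origin, at most one nonzero point is
    mapped into a given line through the origin.\<close>
  have scale: "t = t'"
    if ab: "(a, b) \<noteq> (0, 0)" and uw: "(u, w) \<noteq> (0, 0)" and "t \<noteq> 0" "t' \<noteq> 0"
      and t: "phi k (t * u, t * w) \<in> line a b 0" and t': "phi k (t' * u, t' * w) \<in> line a b 0"
    for a b u w t t' :: 'a
  proof -
    let ?s = "2 ^ k"
    define A where "A = a * u ^ ?s + b * w ^ ?s"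
    define B where "B = a * w + b * (u + w)"
    have t: "A * t ^ ?s + B * t = 0" and t': "A * t' ^ ?s + B * t' = 0"
      using t t' by (simp_all add: A_def B_def phi_def power_mult_distrib algebra_simps)
    have "A \<noteq> 0"
    proof
      assume "A = 0"
      then have "B = 0"
        using t \<open>t \<noteq> 0\<close> by simp
      let ?d = "u ^ ?s * (u + w) - w ^ ?s * w"
      \<comment> \<open>\<open>A = B = 0\<close> is a linear system for \<open>a\<close> and
        \<open>b\<close> with determinant \<open>?d\<close>; these identities solve it by
        elimination.\<close>
      have "a * ?d = (u + w) * A - w ^ ?s * B" "b * ?d = u ^ ?s * B - w * A"
        by (simp_all add: A_def B_def algebra_simps)
      then have "?d = 0"
        using ab \<open>A = 0\<close> \<open>B = 0\<close> by auto
      then show False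
        using phi_determinant_nonzero[OF card cop uw] by simp
    qed
    \<comment> \<open>Eliminating \<open>B\<close> from the two equations shows that the
      automorphism fixes the ratio \<open>t / t'\<close>.\<close>
    have "A * (t ^ ?s * t' - t' ^ ?s * t) = (A * t ^ ?s + B * t) * t' - (A * t' ^ ?s + B * t') * t"
      by (simp add: algebra_simps)
    then have "t ^ ?s * t' = t' ^ ?s * t"
      using \<open>A \<noteq> 0\<close> by (simp add: t t')
    then have "(t / t') ^ ?s = t / t'"
      using \<open>t' \<noteq> 0\<close> by (simp add: power_divide frac_eq_eq mult.commute)
    then have "t / t' = 0 \<or> t / t' = 1"
      by (intro power_2_power_fixed[OF card]) (use cop in auto)
    then show ?thesis
      using \<open>t \<noteq> 0\<close> \<open>t' \<noteq> 0\<close> by auto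
  qed
  have three: "p0 = p1 \<or> p0 = p2 \<or> p1 = p2"
    if ab: "(a, b) \<noteq> (0, 0)" and ab': "(a', b') \<noteq> (0, 0)"
      and p: "p0 \<in> line a' b' c'" "p1 \<in> line a' b' c'" "p2 \<in> line a' b' c'"
      and f: "phi k p0 \<in> line a b c" "phi k p1 \<in> line a b c" "phi k p2 \<in> line a b c"
    for a b c a' b' c' :: 'a and p0 p1 p2
  proof -
    \<comment> \<open>With \<open>p0\<close> as base point, additivity of \<open>phi k\<close>
      removes the constants \<open>c\<close> and \<open>c'\<close>, which reduces the claim to
      \<open>scale\<close>.\<close>
    have *: "\<exists>t. p = p0 + (t * - b', t * a') \<and> phi k (t * - b', t * a') \<in> line a b 0"
      if q: "p \<in> line a' b' c'" "phi k p \<in> line a b c" for p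
    proof -
      obtain x y x' y' where xy: "p0 = (x, y)" "p = (x', y')"
        by (metis surj_pair)
      obtain t where "x' = x - t * b'" "y' = y + t * a'"
        by (rule line_direction[OF ab' p(1)[unfolded xy(1)] q(1)[unfolded xy(2)]])
      then have t: "p = p0 + (t * - b', t * a')"
        by (simp add: xy)
      have "phi k (t * - b', t * a') = phi k p - phi k p0"
        by (simp add: t phi_add[OF two])
      then have "phi k (t * - b', t * a') \<in> line a b 0"
        using q(2) f(1) by (cases "phi k p"; cases "phi k p0") (simp add: algebra_simps)
      with t show ?thesis
        by blast
    qed
    obtain t1 t2 where
      "p1 = p0 + (t1 * - b', t1 * a')" "phi k (t1 * - b', t1 * a') \<in> line a b 0"
      "p2 = p0 + (t2 * - b', t2 * a')" "phi k (t2 * - b', t2 * a') \<in> line a b 0"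
      using *[OF p(2) f(2)] *[OF p(3) f(3)] by blast
    moreover from this have "t1 = 0 \<or> t2 = 0 \<or> t1 = t2"
      using scale[OF ab, of "- b'" a' t1 t2] ab' by auto
    ultimately show ?thesis
      by (auto simp: zero_prod_def)
  qed
  have "card (l \<inter> phi k ` m) \<le> 2"
    if lm: "l \<in> lines (AG2 :: ('a \<times> 'a) plane)" "m \<in> lines AG2" for l m
  proof (rule ccontr)
    assume "\<not> card (l \<inter> phi k ` m) \<le> 2"
    then have "3 \<le> card (l \<inter> phi k ` m)"
      by simp
    then obtain T where "T \<subseteq> l \<inter> phi k ` m" "card T = 3" "finite T"
      by (rule obtain_subset_with_card_n)
    then obtain r0 r1 r2 where
      "r0 \<in> l \<inter> phi k ` m" "r1 \<in> l \<inter> phi k ` m" "r2 \<in> l \<inter> phi k ` m"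
      "r0 \<noteq> r1" "r0 \<noteq> r2" "r1 \<noteq> r2"
      by (metis card_3_iff insert_subset)
    then obtain p0 p1 p2 where "p0 \<in> m" "p1 \<in> m" "p2 \<in> m"
      "phi k p0 \<in> l" "phi k p1 \<in> l" "phi k p2 \<in> l"
      "p0 \<noteq> p1" "p0 \<noteq> p2" "p1 \<noteq> p2"
      by blast
    moreover obtain a b c where "l = line a b c" "(a, b) \<noteq> (0, 0)"
      using lm(1) unfolding lines_AG2 by blast
    moreover obtain a' b' c' where "m = line a' b' c'" "(a', b') \<noteq> (0, 0)"
      using lm(2) unfolding lines_AG2 by blast
    ultimately show False
      using three by metis
  qed
  moreover have "affine_plane_of_order CARD('a) (plane_image AG2 (phi k :: 'a \<times> 'a \<Rightarrow> _))"
    using affine_plane_of_order_plane_image[OF affine_plane_of_order_AG2] bij_phi[OF card cop]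
    by simp
  ultimately show ?thesis
    unfolding orthogoval_def lines_plane_image
    using affine_plane_of_order_AG2[where 'a = 'a] by auto
qed

section \<open>The square of the map and the swap of coordinates\<close>

lemma plane_image_swap_AG2: "plane_image AG2 prod.swap = (AG2 :: ('a::field \<times> 'a) plane)"
proof -
  have swap: "prod.swap ` line a b c = line b a c" for a b c :: 'a
    by (auto simp: line_def image_iff add.commute)
  have "(\<lambda>l. prod.swap ` l) ` lines AG2 = lines (AG2 :: ('a \<times> 'a) plane)"
    unfolding lines_AG2 by (auto simp: swap image_iff) (metis swap)+
  then show ?thesis
    by (simp add: plane_image_def)
qed

text \<open>The matrix \<open>M\<close> has entries 0 and 1, so it commutes with the automorphism
  and the mixed terms of the square cancel in pairs. What remains is the squared automorphism plus
  \<open>M\<close> squared, and \<open>M\<close> squared is \<open>M\<close> conjugated by the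
  swap.\<close>

lemma phi_comp_phi:
  assumes "(2::'a::field) = 0"
  shows "phi k \<circ> phi k = prod.swap \<circ> phi (2 * k) \<circ> (prod.swap :: 'a \<times> 'a \<Rightarrow> _)"
proof
  fix p :: "'a \<times> 'a"
  obtain x y where p: "p = (x, y)"
    by (cases p)
  have double: "z + z = 0" for z :: 'a
    using assms by (metis mult_2 mult_zero_left)
  then have cancel: "z + (z + t) = t" for z t :: 'a
    by (simp flip: add.assoc)
  have "(z ^ 2 ^ k) ^ 2 ^ k = z ^ 2 ^ (2 * k)" for z :: 'a
    by (simp add: mult_2 power_add flip: power_mult)
  then show "(phi k \<circ> phi k) p = (prod.swap \<circ> phi (2 * k) \<circ> prod.swap) p"
    by (simp add: p phi_def add_power_2_power[OF assms] double cancel ac_simps)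
qed

theorem theorem3p15:
  fixes n k :: nat
  assumes "n > 0" and "k > 0"
    and "gcd (6 * k) n = 1"
    and "CARD('a::{field,finite}) = 2 ^ n"
  shows "bij (phi k :: 'a \<times> 'a \<Rightarrow> 'a \<times> 'a) \<and>
         mutually_orthogoval
           [AG2 :: ('a \<times> 'a) plane, plane_image AG2 (phi k), plane_image AG2 (phi k \<circ> phi k)]"
proof -
  let ?A = "AG2 :: ('a \<times> 'a) plane"
  have "coprime (2 * (3 * k)) n"
    using assms(3) by (simp add: coprime_iff_gcd_eq_1)
  \<comment> \<open>The second condition is the first with \<open>2 * k\<close> in place of
    \<open>k\<close>; here the factor 2 in the gcd, that is, \<open>n\<close> odd, enters.\<close>
  then have cop: "coprime (3 * k) n" "coprime (3 * (2 * k)) n"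
    by (simp_all only: coprime_mult_left_iff)
  have bij: "bij (phi k :: 'a \<times> 'a \<Rightarrow> 'a \<times> 'a)"
    by (rule bij_phi[OF assms(4) cop(1)])
  have 1: "orthogoval ?A (plane_image ?A (phi k))"
    by (rule orthogoval_AG2_phi[OF assms(4) cop(1)])
  have 2: "orthogoval (plane_image ?A (phi k)) (plane_image ?A (phi k \<circ> phi k))"
    using orthogoval_plane_image[OF 1, of "phi k"] bij by (simp add: plane_image_comp)
  \<comment> \<open>Applying the swap to the pair for \<open>2 * k\<close> supplies the outer swap
    of \<open>phi_comp_phi\<close>; the inner one is absorbed because the swap preserves
    \<open>AG2\<close>.\<close>
  have "orthogoval (plane_image ?A prod.swap) (plane_image (plane_image ?A (phi (2 * k))) prod.swap)"
    by (rule orthogoval_plane_image[OF orthogoval_AG2_phi[OF assms(4) cop(2)]]) simp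
  then have 3: "orthogoval ?A (plane_image ?A (phi k \<circ> phi k))"
    unfolding phi_comp_phi[OF even_field(2)[OF assms(4)]] plane_image_comp plane_image_swap_AG2 .
  show ?thesis
    using bij 1 2 3 orthogoval_sym[OF 1] orthogoval_sym[OF 2] orthogoval_sym[OF 3]
    by (simp add: mutually_orthogoval_def numeral_3_eq_3 All_less_Suc)
qed

end
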